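(* Let $G$ be a finite non-solvable group. Then $\mathcal{NS}_G$ is not a complete multi-partite graph. In particular, $\mathcal{NS}_G$ is not a complete bipartite graph.
   Context: For a group $G$, $\mathrm{Sol}(G)=\{x\in G : \langle x,y\rangle \text{ is solvable for all } y\in G\}$. The non-solvable graph $\mathcal{NS}_G$ is the simple graph with vertex set $G\setminus \mathrm{Sol}(G)$ in which two distinct vertices $x,y$ are adjacent if and only if $\langle x,y\rangle$ is not solvable. *)

theory Defs
  imports
    "HOL-Algebra.Solvable_Groups"
    "HOL-Library.Disjoint_Sets"
    "Graph_Theory.Graph_Theory"
begin

definition Sol :: "('a, 'b) monoid_scheme \<Rightarrow> 'a set" where
  "Sol G = {x \<in> carrier G.
     \<forall>y \<in> carrier G. solvable (G\<lparr>carrier := generate G {x, y}\<rparr>)}"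

text \<open>A simple graph is encoded as in \<open>Graph_Theory\<close>: a loop-free symmetric digraph without
  parallel arcs, each undirected edge being represented by its two orientations.\<close>

definition nonsolvable_graph :: "('a, 'b) monoid_scheme \<Rightarrow> 'a pair_pre_digraph" where
  "nonsolvable_graph G =
     \<lparr>pverts = carrier G - Sol G,
      parcs = {(x, y). x \<in> carrier G - Sol G \<and> y \<in> carrier G - Sol G \<and> x \<noteq> y \<and>
        \<not> solvable (G\<lparr>carrier := generate G {x, y}\<rparr>)}\<rparr>"

text \<open>The parts are nonempty (this is part of \<^const>\<open>partition_on\<close>), and a multi-partite
  graph has at least two of them.\<close>

definition complete_partite_digraph :: "nat \<Rightarrow> ('a, 'b) pre_digraph \<Rightarrow> bool" where
  "complete_partite_digraph k \<Gamma> \<longleftrightarrow> graph \<Gamma> \<and>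
     (\<exists>P. partition_on (verts \<Gamma>) P \<and> finite P \<and> card P = k \<and>
       arcs_ends \<Gamma> = {(u, v). \<exists>A\<in>P. \<exists>B\<in>P. A \<noteq> B \<and> u \<in> A \<and> v \<in> B})"

definition complete_multipartite_digraph :: "('a, 'b) pre_digraph \<Rightarrow> bool" where
  "complete_multipartite_digraph \<Gamma> \<longleftrightarrow> (\<exists>k\<ge>2. complete_partite_digraph k \<Gamma>)"

lemma pair_graph_nonsolvable_graph:
  assumes "group G" "finite (carrier G)"
  shows "pair_graph (nonsolvable_graph G)"
proof -
  have "parcs (nonsolvable_graph G) \<subseteq> carrier G \<times> carrier G"
    by (auto simp: nonsolvable_graph_def)
  then have "finite (parcs (nonsolvable_graph G))"
    using assms(2) finite_subset by blast
  then show ?thesis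
    using assms(2)
    by unfold_locales
      (auto simp: nonsolvable_graph_def symmetric_def insert_commute intro!: symI)
qed

text \<open>The library's \<^const>\<open>complete_bipartite_digraph\<close> allows empty sides; with both sides
  nonempty it is the case of two parts.\<close>

lemma complete_partite_2_iff:
  "complete_partite_digraph 2 \<Gamma> \<longleftrightarrow>
     (\<exists>m\<ge>1. \<exists>n\<ge>1. complete_bipartite_digraph m n \<Gamma>)"
proof
  assume "complete_partite_digraph 2 \<Gamma>"
  then obtain P where g: "graph \<Gamma>" and P: "partition_on (verts \<Gamma>) P" "card P = 2"
    and a: "arcs_ends \<Gamma> = {(u, v). \<exists>A\<in>P. \<exists>B\<in>P. A \<noteq> B \<and> u \<in> A \<and> v \<in> B}"
    by (auto simp: complete_partite_digraph_def)
  from P(2) obtain U V where UV: "P = {U, V}" "U \<noteq> V"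
    by (meson card_2_iff)
  interpret graph \<Gamma> by fact
  have e: "verts \<Gamma> = U \<union> V" "U \<inter> V = {}" "U \<noteq> {}" "V \<noteq> {}"
    using P(1) UV by (auto simp: partition_on_def disjoint_def)
  have "finite U" "finite V"
    using finite_verts e(1) by auto
  then have c: "card U \<ge> 1" "card V \<ge> 1"
    using e by (auto simp: Suc_le_eq card_gt_0_iff)
  have "arcs_ends \<Gamma> = U \<times> V \<union> V \<times> U"
    using a UV by auto
  then have "complete_bipartite_digraph (card U) (card V) \<Gamma>"
    using g e unfolding complete_bipartite_digraph_def by blast
  then show "\<exists>m\<ge>1. \<exists>n\<ge>1. complete_bipartite_digraph m n \<Gamma>"
    using c by blast
next
  assume "\<exists>m\<ge>1. \<exists>n\<ge>1. complete_bipartite_digraph m n \<Gamma>"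
  then obtain U V where g: "graph \<Gamma>" and e: "verts \<Gamma> = U \<union> V" "U \<inter> V = {}"
    and c: "card U \<ge> 1" "card V \<ge> 1" and a: "arcs_ends \<Gamma> = U \<times> V \<union> V \<times> U"
    by (auto simp: complete_bipartite_digraph_def)
  have ne: "U \<noteq> {}" "V \<noteq> {}"
    using c by auto
  then have "U \<noteq> V"
    using e by auto
  moreover have "partition_on (verts \<Gamma>) {U, V}"
    using e ne by (auto simp: partition_on_def disjoint_def)
  ultimately show "complete_partite_digraph 2 \<Gamma>"
    using g a unfolding complete_partite_digraph_def
    by (intro conjI exI[of _ "{U, V}"]) auto
qed

end

theory Submission
  imports
    Defs
    "HOL-Algebra.Sylow"
    "HOL-Algebra.Group_Action"
    "HOL-Algebra.Multiplicative_Group"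
begin

text \<open>
  Write \<open>x ~ y\<close> if \<open>x\<close> and \<open>y\<close> generate a solvable subgroup. If the non-solvable graph is
  complete multipartite, then \<open>~\<close> is an equivalence relation outside \<open>Sol G\<close> with at least
  two classes. Such a relation is impossible in a finite group, by an elementary count.

  Replacing the group by the subgroup generated by two inequivalent elements, one may assume that
  it is generated by elements outside \<open>S = Sol G\<close>. Then \<open>S\<close> is a subgroup (lemma
  \<open>Sol_mult\<close>). For \<open>x\<close> outside \<open>S\<close> the solvabilizer \<open>A\<close> of \<open>x\<close>, which is the union of
  \<open>S\<close> and the class of \<open>x\<close>, is a subgroup as well: if \<open>y ~ z\<close> then \<open>y ~ y \<otimes> z\<close>.
  So the solvabilizers are proper subgroups that cover the group, are permuted by
  conjugation, and pairwise meet in \<open>S\<close>.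

  The decisive point is that every solvabilizer is its own normaliser (lemma
  \<open>solvabilizer_malnormal\<close>). Indeed, let \<open>P\<close> be a Sylow subgroup of \<open>A\<close> that is not
  contained in \<open>S\<close>. Sylow subgroups of \<open>A\<close> are conjugate in \<open>A\<close>, so an element
  normalising \<open>A\<close> differs by a factor in \<open>A\<close> from an element \<open>n\<close> normalising \<open>P\<close>. As
  \<open>P\<close> is solvable, so is the group generated by \<open>P\<close> and \<open>n\<close>, and \<open>n\<close> is equivalent to
  an element of \<open>P\<close> outside \<open>S\<close>, which lies in the class of \<open>x\<close>.

  Hence \<open>A\<close> has exactly \<open>|G| / |A|\<close> conjugates, and outside \<open>S\<close> they are disjoint and
  cover \<open>|G| (|A| - |S|) / |A|\<close> elements. This number is at least \<open>|G| / 2\<close>, because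
  \<open>|S| \<le> |A| / 2\<close>, and it is less than \<open>|G| - |S|\<close>, because \<open>A\<close> is a proper subgroup. So
  some element outside \<open>S\<close> is not covered. The conjugates of its solvabilizer cover at least
  \<open>|G| / 2\<close> further elements outside \<open>S\<close>, which is too many.
\<close>

section \<open>Subgroups and solvability\<close>

text \<open>Together with associativity, these two rules let the simplifier decide identities that
  hold in a free group.\<close>
lemma (in group) inv_mult_cancel_left:
  assumes "x \<in> carrier G" "y \<in> carrier G"
  shows "inv x \<otimes> (x \<otimes> y) = y" "x \<otimes> (inv x \<otimes> y) = y"
  using assms by (simp_all flip: m_assoc)

lemma (in group) finite_submonoid_is_subgroup:
  assumes "finite (carrier G)" "H \<subseteq> carrier G" "\<one> \<in> H"
    and closed: "\<And>x y. x \<in> H \<Longrightarrow> y \<in> H \<Longrightarrow> x \<otimes> y \<in> H"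
  shows "subgroup H G"
proof
  show "inv x \<in> H" if "x \<in> H" for x
  proof -
    have x: "x \<in> carrier G" using that assms(2) by blast
    have pow: "x [^] (k::nat) \<in> H" for k
      by (induction k) (auto simp: assms(3) closed that)
    have "0 < order G"
      using assms(1) by (simp add: order_gt_0_iff_finite)
    then have "x [^] (order G - 1) \<otimes> x = \<one>"
      by (metis Suc_diff_1 nat_pow_Suc pow_order_eq_1 x)
    then show ?thesis
      using pow x by (metis inv_equality nat_pow_closed)
  qed
qed (use assms in auto)

lemma (in group) solvable_carrier_iff_solvable_seq:
  assumes "subgroup H G"
  shows "solvable (G\<lparr>carrier := H\<rparr>) \<longleftrightarrow> solvable_seq G H"
proof -
  interpret i: group_hom "G\<lparr>carrier := H\<rparr>" G id
    using subgroup_imp_group[OF assms] is_group subgroup.subset[OF assms]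
    by (auto simp: group_hom_def group_hom_axioms_def hom_def)
  show ?thesis
    using i.solvable_img_imp_solvable[OF i.G.subgroup_self] i.solvable_imp_solvable_img[of H]
    by (auto simp: solvable_def)
qed

lemma (in group) solvable_seq_mono:
  assumes "solvable_seq G H" "subgroup K G" "K \<subseteq> H"
  shows "solvable_seq G K"
proof -
  obtain n where "(derived G ^^ n) H = {\<one>}"
    using solvable_imp_trivial_derived_seq[OF assms(1)] by blast
  then have "(derived G ^^ n) K = {\<one>}"
    using mono_exp_of_derived[OF assms(3), of n]
      subgroup.one_closed[OF exp_of_derived_is_subgroup[OF assms(2), of n]] by blast
  then show ?thesis
    by (rule trivial_derived_seq_imp_solvable[OF assms(2)])
qed

text \<open>Because \<open>n\<close> normalises \<open>H\<close>, the products \<open>h \<otimes> n [^] k\<close> form a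
  subgroup, and modulo \<open>H\<close> this subgroup is cyclic. Hence its commutators lie in \<open>H\<close>, and it is an extension of a solvable group by an
  abelian one.\<close>
lemma (in group) solvable_seq_generate_insert:
  assumes fin: "finite (carrier G)" and H: "solvable_seq G H" and n: "n \<in> carrier G"
    and normalizes: "\<And>h. h \<in> H \<Longrightarrow> n \<otimes> h \<otimes> inv n \<in> H"
  shows "solvable_seq G (generate G (insert n H))"
proof -
  interpret H: subgroup H G
    by (rule solvable_imp_subgroup[OF H])
  define D where "D = {h \<otimes> n [^] k | h k. h \<in> H \<and> k \<in> (UNIV :: nat set)}"
  have pow: "n [^] k \<otimes> h \<otimes> inv (n [^] k) \<in> H" if "h \<in> H" for h and k :: nat
    using that
  proof (induction k arbitrary: h)
    case (Suc k)
    have "n [^] Suc k \<otimes> h \<otimes> inv (n [^] Suc k) = n [^] k \<otimes> (n \<otimes> h \<otimes> inv n) \<otimes> inv (n [^] k)"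
      using Suc.prems n by (simp add: inv_mult_group m_assoc)
    then show ?case
      using Suc.IH[OF normalizes[OF Suc.prems]] by metis
  qed auto
  have D: "subgroup D G"
  proof (rule finite_submonoid_is_subgroup[OF fin])
    show "D \<subseteq> carrier G" using n by (auto simp: D_def)
    have "\<one> \<otimes> n [^] (0::nat) \<in> D"
      unfolding D_def using H.one_closed by blast
    then show "\<one> \<in> D" by simp
  next
    fix x y assume "x \<in> D" "y \<in> D"
    then obtain g k h l where x: "x = g \<otimes> n [^] (k::nat)" "g \<in> H"
      and y: "y = h \<otimes> n [^] (l::nat)" "h \<in> H"
      by (auto simp: D_def)
    have "x \<otimes> y = g \<otimes> (n [^] k \<otimes> h \<otimes> inv (n [^] k)) \<otimes> n [^] (k + l)"
      using x y n by (simp add: m_assoc inv_mult_cancel_left flip: nat_pow_mult)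
    moreover have "g \<otimes> (n [^] k \<otimes> h \<otimes> inv (n [^] k)) \<in> H"
      using x y pow by blast
    ultimately show "x \<otimes> y \<in> D"
      unfolding D_def by blast
  qed
  have "derived G D \<subseteq> H"
    unfolding derived_def
  proof (rule generate_subgroup_incl[OF _ H.subgroup_axioms])
    show "derived_set G D \<subseteq> H"
    proof
      fix c assume "c \<in> derived_set G D"
      then obtain g k h l where c: "g \<in> H" "h \<in> H" "c = (g \<otimes> n [^] (k::nat)) \<otimes> (h \<otimes> n [^] (l::nat))
          \<otimes> inv (g \<otimes> n [^] k) \<otimes> inv (h \<otimes> n [^] l)"
        by (auto simp: D_def)
      have comm: "n [^] l \<otimes> (inv (n [^] k) \<otimes> z) = inv (n [^] k) \<otimes> (n [^] l \<otimes> z)"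
        if z: "z \<in> carrier G" for z
      proof -
        have "n [^] k \<otimes> (n [^] l \<otimes> y) = n [^] l \<otimes> (n [^] k \<otimes> y)" if "y \<in> carrier G" for y
          using n that by (simp add: nat_pow_mult add.commute flip: m_assoc)
        from this[of "inv (n [^] k) \<otimes> z"] show ?thesis
          using n z by (metis inv_closed inv_mult_cancel_left m_closed nat_pow_closed)
      qed
      \<comment> \<open>The factors are \<open>g\<close>, a conjugate of \<open>h\<close>, a conjugate of the inverse of \<open>g\<close>, and the inverse of \<open>h\<close>.\<close>
      have "c = g \<otimes> (n [^] k \<otimes> h \<otimes> inv (n [^] k)) \<otimes> (n [^] l \<otimes> inv g \<otimes> inv (n [^] l)) \<otimes> inv h"
        using c n by (simp add: m_assoc inv_mult_group inv_mult_cancel_left comm)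
      then show "c \<in> H"
        using c(1,2) pow by (simp add: H.m_closed H.m_inv_closed)
    qed
  qed
  then have "solvable_seq G D"
    using augment_solvable_seq[OF D] solvable_seq_mono[OF H derived_is_subgroup[OF subgroup.subset[OF D]]]
    by blast
  moreover have "generate G (insert n H) \<subseteq> D"
  proof (rule generate_subgroup_incl[OF _ D])
    have "h \<otimes> n [^] (0::nat) \<in> D" if "h \<in> H" for h
      unfolding D_def using that by blast
    then have "H \<subseteq> D"
      by auto
    moreover have "\<one> \<otimes> n [^] (1::nat) \<in> D"
      unfolding D_def using H.one_closed by blast
    ultimately show "insert n H \<subseteq> D"
      using n by simp
  qed
  ultimately show ?thesis
    using solvable_seq_mono[OF _ generate_is_subgroup[of "insert n H"]] n H.subset by blast
qed

section \<open>Actions of p-groups\<close>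

text \<open>An action is a homomorphism into a bijection group, whose elements are extensional
  functions; hence the restriction of an ordinary binary operation to the set acted on.\<close>
lemma (in group) group_action_restrictI:
  assumes closed: "\<And>g x. g \<in> carrier G \<Longrightarrow> x \<in> E \<Longrightarrow> f g x \<in> E"
    and one: "\<And>x. x \<in> E \<Longrightarrow> f \<one> x = x"
    and mult: "\<And>g h x. g \<in> carrier G \<Longrightarrow> h \<in> carrier G \<Longrightarrow> x \<in> E \<Longrightarrow> f (g \<otimes> h) x = f g (f h x)"
  shows "group_action G E (\<lambda>g. \<lambda>x\<in>E. f g x)"
proof -
  have "f (inv g) (f g x) = x" "f g (f (inv g) x) = x" if "g \<in> carrier G" "x \<in> E" for g x
    using that by (simp_all add: one flip: mult)
  then have bij: "bij_betw (f g) E E" if "g \<in> carrier G" for g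
    using that closed by (intro bij_betw_byWitness[where f' = "f (inv g)"]) auto
  have Bij: "(\<lambda>x\<in>E. f g x) \<in> Bij E" if "g \<in> carrier G" for g
    using bij[OF that] by (auto simp: Bij_def intro: bij_betw_restrict_eq[THEN iffD2])
  have "(\<lambda>g. \<lambda>x\<in>E. f g x) \<in> hom G (BijGroup E)"
  proof (rule homI)
    fix g h assume "g \<in> carrier G" "h \<in> carrier G"
    then show "(\<lambda>x\<in>E. f (g \<otimes> h) x) = (\<lambda>x\<in>E. f g x) \<otimes>\<^bsub>BijGroup E\<^esub> (\<lambda>x\<in>E. f h x)"
      using Bij closed by (auto simp: BijGroup_def compose_def mult)
  qed (simp add: BijGroup_def Bij)
  then show ?thesis
    by (simp add: group_action_def group_hom_def group_hom_axioms_def group_BijGroup is_group)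
qed

text \<open>The moved points are the union of the orbits with more than one element. The size of
  such an orbit divides the order of the group, so it is a power of \<open>p\<close> other than \<open>1\<close>.\<close>
lemma (in group_action) prime_dvd_card_moved_points:
  assumes "prime p" "order G = p ^ k" "finite E"
  shows "p dvd card {x \<in> E. \<not> (\<forall>g \<in> carrier G. \<phi> g x = x)}"
proof -
  interpret group G
    using group_hom group_hom.axioms(1) by auto
  define U where "U = {x \<in> E. \<not> (\<forall>g \<in> carrier G. \<phi> g x = x)}"
  define C where "C = {B \<in> orbits G E \<phi>. card B \<noteq> 1}"
  have one: "card B = 1 \<longleftrightarrow> (\<forall>g\<in>carrier G. \<phi> g x = x)"
    if "x \<in> E" "B = orbit G \<phi> x" for B x
  proof
    assume "card B = 1"
    then obtain b where "B = {b}"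
      using card_1_singletonE by blast
    then show "\<forall>g\<in>carrier G. \<phi> g x = x"
      using orbit_refl[OF that(1)] that(2) by (auto simp: orbit_def)
  next
    assume "\<forall>g\<in>carrier G. \<phi> g x = x"
    then have "B = {x}"
      using that(2) orbit_refl[OF that(1)] by (auto simp: orbit_def)
    then show "card B = 1" by simp
  qed
  have "U = \<Union>C"
  proof
    show "U \<subseteq> \<Union>C"
    proof
      fix x assume "x \<in> U"
      then have "x \<in> orbit G \<phi> x" "orbit G \<phi> x \<in> C"
        using orbit_refl one by (auto simp: U_def C_def orbits_def)
      then show "x \<in> \<Union>C" by blast
    qed
    show "\<Union>C \<subseteq> U"
    proof
      fix x assume "x \<in> \<Union>C"
      then obtain y where y: "y \<in> E" "x \<in> orbit G \<phi> y" "card (orbit G \<phi> y) \<noteq> 1"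
        by (auto simp: C_def orbits_def)
      have x: "x \<in> E"
        using y element_image by (auto simp: orbit_def)
      have "orbit G \<phi> x = orbit G \<phi> y"
        using disjoint_union[of "orbit G \<phi> x" "orbit G \<phi> y"] x y orbit_refl[OF x]
        by (auto simp: orbits_def)
      then show "x \<in> U"
        using one[OF x refl] x y by (auto simp: U_def)
    qed
  qed
  moreover have "p dvd card (\<Union>C)"
  proof (rule dvd_partition)
    show "finite (\<Union>C)"
      unfolding \<open>U = \<Union>C\<close>[symmetric] U_def using assms(3) by simp
    show "\<forall>B\<in>C. p dvd card B"
    proof
      fix B assume B: "B \<in> C"
      then obtain x where x: "x \<in> E" "B = orbit G \<phi> x"
        by (auto simp: C_def orbits_def)
      have "card B * card (stabilizer G \<phi> x) = p ^ k"
        using orbit_stabilizer_theorem[OF x(1)] x(2) assms(2) by simp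
      then have "card B dvd p ^ k"
        by (metis dvd_triv_left)
      then obtain i where "card B = p ^ i"
        using divides_primepow_nat[OF assms(1)] by blast
      then show "p dvd card B"
        using B by (cases i) (auto simp: C_def)
    qed
    show "\<forall>B\<in>C. \<forall>B'\<in>C. B \<noteq> B' \<longrightarrow> B \<inter> B' = {}"
      using disjoint_union by (auto simp: C_def)
  qed
  ultimately show ?thesis
    by (simp add: U_def)
qed

text \<open>The preceding lemma for the action of \<open>H\<close> on the right cosets of \<open>K\<close> by right
  multiplication. For a left action the inverse of \<open>h\<close> has to be used, which does not change
  the fixed points.\<close>
lemma (in group) prime_dvd_card_moved_rcosets:
  assumes fin: "finite (carrier G)" and H: "subgroup H G" and K: "subgroup K G"
    and p: "prime p" "card H = p ^ k"
  shows "p dvd card {C \<in> rcosets K. \<not> (\<forall>h \<in> H. C #> h = C)}"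
proof -
  interpret H: subgroup H G by fact
  interpret P: group "G\<lparr>carrier := H\<rparr>" by (rule subgroup_imp_group[OF H])
  have K_sub: "K \<subseteq> carrier G" by (rule subgroup.subset[OF K])
  have coset: "C \<subseteq> carrier G" if "C \<in> rcosets K" for C
    using that subgroup.rcosets_carrier[OF K is_group] by blast
  have closed: "C #> g \<in> rcosets K" if "C \<in> rcosets K" "g \<in> carrier G" for C g
    using that K_sub by (auto simp: RCOSETS_def coset_mult_assoc)
  have act: "group_action (G\<lparr>carrier := H\<rparr>) (rcosets K) (\<lambda>h. \<lambda>C\<in>rcosets K. C #> inv h)"
    by (rule P.group_action_restrictI)
      (auto simp: closed coset coset_mult_assoc inv_mult_group)
  have "p dvd card {C \<in> rcosets K. \<not> (\<forall>h \<in> carrier (G\<lparr>carrier := H\<rparr>). (\<lambda>C\<in>rcosets K. C #> inv h) C = C)}"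
    using fin rcosets_part_G[OF K] p
    by (intro group_action.prime_dvd_card_moved_points[OF act, where p = p and k = k])
      (auto simp: order_def intro: finite_UnionD)
  moreover have "(\<forall>h\<in>H. C #> inv h = C) \<longleftrightarrow> (\<forall>h\<in>H. C #> h = C)" for C
    by (metis H.m_inv_closed H.mem_carrier inv_inv)
  ultimately show ?thesis
    by (simp cong: conj_cong)
qed

text \<open>Fixed cosets are what the counting is about: an element fixing \<open>K #> g\<close> is conjugated
  into \<open>K\<close> by \<open>g\<close>.\<close>
lemma (in group) rcos_fixed_iff_conj_mem:
  assumes K: "subgroup K G" and "g \<in> carrier G" "h \<in> carrier G"
  shows "(K #> g) #> h = K #> g \<longleftrightarrow> g \<otimes> h \<otimes> inv g \<in> K"
proof -
  have "(K #> g) #> h = K #> g \<longleftrightarrow> K #> (g \<otimes> h) = K #> g"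
    using assms by (simp add: coset_mult_assoc subgroup.subset)
  also have "\<dots> \<longleftrightarrow> g \<otimes> h \<in> K #> g"
    using assms rcos_self[of "g \<otimes> h" K] repr_independence[of "g \<otimes> h" K g] by auto
  also have "\<dots> \<longleftrightarrow> g \<otimes> h \<otimes> inv g \<in> K"
    using assms subgroup.rcos_module[OF K is_group, of g "g \<otimes> h"] by simp
  finally show ?thesis .
qed

text \<open>If the number of cosets is prime to \<open>p\<close>, not all of them can be moved. A coset fixed by
  all of \<open>H\<close> yields the conjugating element. With \<open>K\<close> a Sylow subgroup, this is the conjugacy
  part of Sylow's theorem.\<close>
lemma (in group) p_subgroup_conj_into:
  assumes fin: "finite (carrier G)" and H: "subgroup H G" and K: "subgroup K G"
    and p: "prime p" "card H = p ^ k" and index: "\<not> p dvd card (rcosets K)"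
  shows "\<exists>g \<in> carrier G. \<forall>h \<in> H. g \<otimes> h \<otimes> inv g \<in> K"
proof -
  have "{C \<in> rcosets K. \<not> (\<forall>h \<in> H. C #> h = C)} \<noteq> rcosets K"
    using prime_dvd_card_moved_rcosets[OF fin H K p] index by metis
  then obtain C where C: "C \<in> rcosets K" "\<forall>h\<in>H. C #> h = C" by blast
  then obtain g where g: "g \<in> carrier G" "C = K #> g" by (auto simp: RCOSETS_def)
  then show ?thesis
    using C(2) rcos_fixed_iff_conj_mem[OF K g(1)] subgroup.mem_carrier[OF H] by blast
qed

text \<open>Let \<open>K\<close> act on its own cosets. It fixes the coset \<open>K\<close>, and the number of fixed
  cosets is divisible by \<open>p\<close>, so it fixes another one. Representatives of fixed cosets
  normalise \<open>K\<close>.\<close>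
lemma (in group) p_group_normalizer_grows:
  assumes p: "prime p" "order G = p ^ k" and K: "subgroup K G" "K \<noteq> carrier G"
  shows "\<exists>g \<in> carrier G - K. \<forall>h \<in> K. g \<otimes> h \<otimes> inv g \<in> K"
proof (rule ccontr)
  assume none: "\<not> ?thesis"
  have fin: "finite (carrier G)"
    using p prime_gt_0_nat[OF p(1)] by (simp flip: order_gt_0_iff_finite)
  have lag: "card (rcosets K) * card K = p ^ k"
    using lagrange[OF K(1)] p(2) by simp
  obtain i where i: "card (rcosets K) = p ^ i"
    using divides_primepow_nat[OF p(1), of "card (rcosets K)" k] dvd_triv_left[of "card (rcosets K)" "card K"] lag
    by auto
  obtain j where j: "card K = p ^ j"
    using divides_primepow_nat[OF p(1), of "card K" k] dvd_triv_right[of "card K" "card (rcosets K)"] lag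
    by auto
  have "card (rcosets K) \<noteq> 1"
  proof
    assume "card (rcosets K) = 1"
    then have "card K = card (carrier G)"
      using lag p(2) by (simp add: order_def)
    then show False
      using card_subset_eq[OF fin subgroup.subset[OF K(1)]] K(2) by blast
  qed
  then have "p dvd card (rcosets K)"
    using i by (cases i) auto
  moreover have "C = K" if C: "C \<in> rcosets K" "\<forall>h \<in> K. C #> h = C" for C
  proof -
    obtain g where g: "g \<in> carrier G" "C = K #> g" using C by (auto simp: RCOSETS_def)
    then have "g \<in> K"
      using none C(2) rcos_fixed_iff_conj_mem[OF K(1) g(1)] subgroup.mem_carrier[OF K(1)] by blast
    then show ?thesis
      using g subgroup.rcos_const[OF K(1) is_group] by blast
  qed
  moreover have "K #> h = K" if "h \<in> K" for h
    using that subgroup.rcos_const[OF K(1) is_group] by blast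
  ultimately have moved: "{C \<in> rcosets K. \<not> (\<forall>h \<in> K. C #> h = C)} = rcosets K - {K}"
    by blast
  have "finite (rcosets K)"
    using fin rcosets_part_G[OF K(1)] by (auto intro: finite_UnionD)
  then have "card (rcosets K) = Suc (card (rcosets K - {K}))"
    using subgroup.subgroup_in_rcosets[OF K(1) is_group] by (simp add: card_Suc_Diff1 del: card_Diff_insert)
  moreover have "p dvd card (rcosets K - {K})"
    using prime_dvd_card_moved_rcosets[OF fin K(1) K(1) p(1) j] moved by simp
  ultimately show False
    using \<open>p dvd card (rcosets K)\<close> not_prime_unit[of p] p(1)
    by (metis dvd_add_right_iff Suc_eq_plus1)
qed

text \<open>A maximal solvable subgroup is the whole group: otherwise an element outside it normalises
  it, and adjoining that element gives a larger solvable subgroup.\<close>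
lemma (in group) p_group_solvable:
  assumes p: "prime p" "order G = p ^ k"
  shows "solvable G"
proof -
  have fin: "finite (carrier G)"
    using p prime_gt_0_nat[OF p(1)] by (simp flip: order_gt_0_iff_finite)
  have "finite {H. solvable_seq G H}"
    by (rule finite_subset[of _ "Pow (carrier G)"])
      (use fin subgroup.subset solvable_imp_subgroup in blast)+
  then obtain H where H: "solvable_seq G H"
    and max: "\<And>H'. solvable_seq G H' \<Longrightarrow> H \<subseteq> H' \<Longrightarrow> H' = H"
    using finite_has_maximal[of "{H. solvable_seq G H}"] solvable_seq.unity by blast
  have "H = carrier G"
  proof (rule ccontr)
    assume "H \<noteq> carrier G"
    then obtain g where g: "g \<in> carrier G - H" "\<forall>h \<in> H. g \<otimes> h \<otimes> inv g \<in> H"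
      using p_group_normalizer_grows[OF p solvable_imp_subgroup[OF H]] by blast
    then have "solvable_seq G (generate G (insert g H))"
      using solvable_seq_generate_insert[OF fin H] by blast
    moreover have "insert g H \<subseteq> generate G (insert g H)"
      by (auto intro: generate.incl)
    ultimately show False
      using max g(1) by blast
  qed
  then show ?thesis
    using H by (simp add: solvable_def)
qed

section \<open>Sylow subgroups of a subgroup\<close>

lemma (in group) card_subgroup_dvd:
  assumes A: "subgroup A G" and B: "subgroup B G" "B \<subseteq> A"
  shows "card B dvd card A"
proof -
  have "card (rcosets\<^bsub>G\<lparr>carrier := A\<rparr>\<^esub> B) * card B = card A"
    using group.lagrange[OF subgroup_imp_group[OF A] subgroup_incl[OF B(1) A B(2)]]
    by (simp add: order_def)
  then show ?thesis
    by (rule dvdI[OF trans[OF sym mult.commute]])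
qed

text \<open>The order of \<open>P\<close> is the full \<open>p\<close>-part of the order of \<open>A\<close>. The last property
  expresses this in the form in which it is used: a subgroup of \<open>A\<close> whose index is divisible by
  \<open>p\<close> does not contain \<open>P\<close>.\<close>
lemma (in group) ex_sylow_subgroup:
  assumes fin: "finite (carrier G)" and A: "subgroup A G" and p: "prime p"
  obtains P k where "subgroup P G" "P \<subseteq> A" "card P = p ^ k"
    "\<And>Q. subgroup Q G \<Longrightarrow> Q \<subseteq> A \<Longrightarrow> card Q = p ^ k \<Longrightarrow> \<exists>g\<in>A. \<forall>h\<in>Q. g \<otimes> h \<otimes> inv g \<in> P"
    "\<And>B. subgroup B G \<Longrightarrow> P \<subseteq> B \<Longrightarrow> B \<subseteq> A \<Longrightarrow> \<not> p dvd (card A div card B)"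
proof -
  interpret A: group "G\<lparr>carrier := A\<rparr>" by (rule subgroup_imp_group[OF A])
  have A_sub: "A \<subseteq> carrier G" by (rule subgroup.subset[OF A])
  then have finA: "finite A" using fin finite_subset by blast
  have "card A \<noteq> 0"
    using finA subgroup.one_closed[OF A] by auto
  then obtain k r where r: "card A = p ^ k * r" "\<not> p dvd r"
    using multiplicity_decompose'[of "card A" p] not_prime_unit[of p] p by blast
  obtain P where P: "subgroup P (G\<lparr>carrier := A\<rparr>)" "card P = p ^ k"
    using sylow_thm[OF p A.is_group, of k r] r(1) finA by (auto simp: order_def)
  have PG: "subgroup P G"
    using incl_subgroup[OF A P(1)] .
  have PA: "P \<subseteq> A"
    using subgroup.subset[OF P(1)] by simp
  have pk: "p ^ k > 0"
    using prime_gt_0_nat[OF p] by simp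
  show thesis
  proof (rule that[OF PG PA P(2)])
    fix Q assume Q: "subgroup Q G" "Q \<subseteq> A" "card Q = p ^ k"
    have "card (rcosets\<^bsub>G\<lparr>carrier := A\<rparr>\<^esub> P) * p ^ k = p ^ k * r"
      using A.lagrange[OF P(1)] P(2) r(1) by (simp add: order_def)
    then have "card (rcosets\<^bsub>G\<lparr>carrier := A\<rparr>\<^esub> P) = r"
      using prime_gt_0_nat[OF p] by simp
    then have "\<exists>g\<in>A. \<forall>h\<in>Q. g \<otimes> h \<otimes> inv\<^bsub>G\<lparr>carrier := A\<rparr>\<^esub> g \<in> P"
      using A.p_subgroup_conj_into[OF _ subgroup_incl[OF Q(1) A Q(2)] P(1) p Q(3)] finA r(2) by simp
    then show "\<exists>g\<in>A. \<forall>h\<in>Q. g \<otimes> h \<otimes> inv g \<in> P"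
      using m_inv_consistent[OF A] by simp
  next
    fix B assume B: "subgroup B G" "P \<subseteq> B" "B \<subseteq> A"
    have "card P dvd card B" "card B dvd card A"
      using card_subgroup_dvd PG A B by blast+
    then obtain c d where "card B = card P * c" "card A = card B * d"
      by (auto simp only: dvd_def)
    then have cd: "card B = p ^ k * c" "card A = p ^ k * c * d"
      using P(2) by simp_all
    then have "r = c * d" "c > 0"
      using r(1) pk \<open>card A \<noteq> 0\<close> by auto
    then have "card A div card B = d" "\<not> p dvd d"
      using cd pk r(2) by auto
    then show "\<not> p dvd (card A div card B)" by simp
  qed
qed

lemma (in group) card_subgroup_double:
  assumes fin: "finite (carrier G)" and "subgroup A G" "subgroup B G" "B \<subset> A"
  obtains m where "card A = m * card B" "m \<ge> 2"
proof -
  have finA: "finite A"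
    using fin finite_subset subgroup.subset[OF assms(2)] by blast
  obtain m where m: "card A = m * card B"
    using card_subgroup_dvd[OF assms(2,3)] assms(4) by (metis dvd_div_mult_self psubset_imp_subset)
  have "card B < card A"
    using assms(4) finA psubset_card_mono by blast
  then have "m \<ge> 2"
    using m by (cases m rule: nat.exhaust; cases "m = 1") auto
  then show thesis using m that by blast
qed

section \<open>Pairs generating a solvable subgroup\<close>

definition solvable_pair :: "('a, 'b) monoid_scheme \<Rightarrow> 'a \<Rightarrow> 'a \<Rightarrow> bool" where
  "solvable_pair G x y \<longleftrightarrow> solvable (G\<lparr>carrier := generate G {x, y}\<rparr>)"

lemma solvable_pair_commute: "solvable_pair G x y \<longleftrightarrow> solvable_pair G y x"
  by (simp add: solvable_pair_def insert_commute)

lemma Sol_iff: "x \<in> Sol G \<longleftrightarrow> x \<in> carrier G \<and> (\<forall>y\<in>carrier G. solvable_pair G x y)"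
  by (auto simp: Sol_def solvable_pair_def)

context group
begin

lemma solvable_pair_iff_solvable_seq:
  assumes "x \<in> carrier G" "y \<in> carrier G"
  shows "solvable_pair G x y \<longleftrightarrow> solvable_seq G (generate G {x, y})"
  using assms solvable_carrier_iff_solvable_seq generate_is_subgroup
  by (simp add: solvable_pair_def)

lemma solvable_pair_in_solvable_seq:
  assumes "solvable_seq G H" "x \<in> H" "y \<in> H"
  shows "solvable_pair G x y"
proof -
  have H: "subgroup H G" by (rule solvable_imp_subgroup[OF assms(1)])
  then have x: "x \<in> carrier G" "y \<in> carrier G"
    using assms subgroup.mem_carrier[OF H] by auto
  have "generate G {x, y} \<subseteq> H"
    by (rule generate_subgroup_incl[OF _ H]) (use assms in auto)
  then show ?thesis
    using solvable_seq_mono[OF assms(1) generate_is_subgroup] x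
    by (simp add: solvable_pair_iff_solvable_seq)
qed

lemma solvable_pair_generate:
  assumes "solvable_pair G x y" "x \<in> carrier G" "y \<in> carrier G"
    and "u \<in> generate G {x, y}" "v \<in> generate G {x, y}"
  shows "solvable_pair G u v"
  using assms solvable_pair_in_solvable_seq solvable_pair_iff_solvable_seq by metis

lemma mem_generate_pair:
  assumes "x \<in> carrier G" "y \<in> carrier G"
  shows "x \<in> generate G {x, y}" "y \<in> generate G {x, y}"
    "x \<otimes> y \<in> generate G {x, y}" "inv x \<in> generate G {x, y}" "inv y \<in> generate G {x, y}"
  by (auto intro: generate.intros)

lemma solvable_pair_inv:
  assumes "x \<in> carrier G" "y \<in> carrier G" 
  shows "solvable_pair G (inv x) y \<longleftrightarrow> solvable_pair G x y"
proof -
  have "solvable_pair G (inv x) y" if "solvable_pair G x y" "x \<in> carrier G" for x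
    using that assms(2) by (intro solvable_pair_generate[OF that(1)] mem_generate_pair)
  then show ?thesis
    using assms by (metis inv_closed inv_inv)
qed

text \<open>The pairs \<open>x, y\<close> and \<open>x \<otimes> y, y\<close> generate the same subgroup, as do \<open>x, y\<close> and
  \<open>x \<otimes> y, x\<close>.\<close>
lemma solvable_pair_mult:
  assumes "x \<in> carrier G" "y \<in> carrier G"
  shows "solvable_pair G (x \<otimes> y) y \<longleftrightarrow> solvable_pair G x y"
    and "solvable_pair G (x \<otimes> y) x \<longleftrightarrow> solvable_pair G x y"
proof -
  have r: "solvable_pair G (x \<otimes> y) y" if "solvable_pair G x y" "x \<in> carrier G" "y \<in> carrier G" for x y
    using that by (intro solvable_pair_generate[OF that(1)] mem_generate_pair)
  have l: "solvable_pair G (x \<otimes> y) x" if "solvable_pair G x y" "x \<in> carrier G" "y \<in> carrier G" for x y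
    using that by (intro solvable_pair_generate[OF that(1)] mem_generate_pair)
  have "x = (x \<otimes> y) \<otimes> inv y"
    using assms by (simp add: m_assoc)
  moreover have "solvable_pair G (x \<otimes> y) (inv y)" if "solvable_pair G (x \<otimes> y) y"
    using that assms by (metis m_closed solvable_pair_commute solvable_pair_inv)
  ultimately have "solvable_pair G x (inv y)" if "solvable_pair G (x \<otimes> y) y"
    using r[of "x \<otimes> y" "inv y"] that assms by simp
  then show "solvable_pair G (x \<otimes> y) y \<longleftrightarrow> solvable_pair G x y"
    using r[OF _ assms] assms by (metis solvable_pair_commute solvable_pair_inv)
  have "y = inv x \<otimes> (x \<otimes> y)"
    using assms by (simp add: inv_mult_cancel_left)
  moreover have "solvable_pair G (inv x) (x \<otimes> y)" if "solvable_pair G (x \<otimes> y) x"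
    using that assms by (metis m_closed solvable_pair_commute solvable_pair_inv)
  ultimately have "solvable_pair G y (inv x)" if "solvable_pair G (x \<otimes> y) x"
    using l[of "inv x" "x \<otimes> y"] that assms by simp
  then show "solvable_pair G (x \<otimes> y) x \<longleftrightarrow> solvable_pair G x y"
    using l[OF _ assms] assms by (metis solvable_pair_commute solvable_pair_inv)
qed

lemma group_hom_conj:
  assumes "g \<in> carrier G"
  shows "group_hom G G (\<lambda>x. g \<otimes> x \<otimes> inv g)"
  using assms is_group
  by (auto simp: group_hom_def group_hom_axioms_def hom_def m_assoc inv_mult_cancel_left)

lemma solvable_pair_conj:
  assumes "solvable_pair G x y" "g \<in> carrier G" "x \<in> carrier G" "y \<in> carrier G"
  shows "solvable_pair G (g \<otimes> x \<otimes> inv g) (g \<otimes> y \<otimes> inv g)"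
proof -
  interpret c: group_hom G G "\<lambda>x. g \<otimes> x \<otimes> inv g"
    by (rule group_hom_conj[OF assms(2)])
  have "solvable_seq G ((\<lambda>x. g \<otimes> x \<otimes> inv g) ` generate G {x, y})"
    using assms by (intro c.solvable_imp_solvable_img) (simp add: solvable_pair_iff_solvable_seq)
  then show ?thesis
    by (rule solvable_pair_in_solvable_seq) (use assms mem_generate_pair in auto)
qed

lemma conj_inv_conj:
  assumes "g \<in> carrier G" "x \<in> carrier G"
  shows "inv g \<otimes> (g \<otimes> x \<otimes> inv g) \<otimes> g = x"
    and "g \<otimes> (inv g \<otimes> x \<otimes> g) \<otimes> inv g = x"
  using assms by (simp_all add: m_assoc inv_mult_cancel_left)

text \<open>Cyclic groups are solvable, as extensions of the trivial group.\<close>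
lemma solvable_pair_self:
  assumes "finite (carrier G)" "x \<in> carrier G"
  shows "solvable_pair G x x"
proof -
  have "solvable_seq G (generate G (insert x {\<one>}))"
    by (rule solvable_seq_generate_insert[OF assms(1) solvable_seq.unity])
      (use assms(2) in auto)
  then show ?thesis
    by (rule solvable_pair_in_solvable_seq) (auto intro: generate.incl)
qed

lemma one_mem_Sol:
  assumes "finite (carrier G)"
  shows "\<one> \<in> Sol G"
proof -
  have "solvable_pair G \<one> y" if "y \<in> carrier G" for y
    by (rule solvable_pair_generate[OF solvable_pair_self[OF assms that]])
      (auto intro: generate.intros that)
  then show ?thesis
    by (simp add: Sol_iff)
qed

lemma Sol_inv: "s \<in> Sol G \<Longrightarrow> inv s \<in> Sol G"
  by (simp add: Sol_iff solvable_pair_inv)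

lemma Sol_conj:
  assumes "s \<in> Sol G" "g \<in> carrier G"
  shows "g \<otimes> s \<otimes> inv g \<in> Sol G"
proof -
  have s: "s \<in> carrier G" "\<And>y. y \<in> carrier G \<Longrightarrow> solvable_pair G s y"
    using assms by (auto simp: Sol_iff)
  have "solvable_pair G (g \<otimes> s \<otimes> inv g) y" if y: "y \<in> carrier G" for y
    using solvable_pair_conj[OF s(2)[of "inv g \<otimes> y \<otimes> g"] assms(2) s(1)] assms(2) y
    by (simp add: conj_inv_conj)
  then show ?thesis
    using s assms by (simp add: Sol_iff)
qed

lemma Sol_conj_iff:
  assumes "x \<in> carrier G" "g \<in> carrier G"
  shows "g \<otimes> x \<otimes> inv g \<in> Sol G \<longleftrightarrow> x \<in> Sol G"
  using Sol_conj[of x g] Sol_conj[of "g \<otimes> x \<otimes> inv g" "inv g"] assms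
  by (auto simp: conj_inv_conj)

end

section \<open>Groups in which solvability of pairs is transitive\<close>

text \<open>Complete multipartite graphs are those in which non-adjacency is transitive, and having at
  least two parts provides an adjacent pair \<open>a, b\<close>. These assumptions are inherited by the
  subgroup that \<open>a\<close> and \<open>b\<close> generate, so the group may be taken to be that subgroup. The
  benefit is a group generated by elements outside \<open>Sol G\<close>, which makes \<open>Sol G\<close> closed
  under multiplication.\<close>
locale transitive_solvability = group G for G (structure) +
  fixes a b
  assumes fin: "finite (carrier G)"
    and ab: "a \<in> carrier G" "b \<in> carrier G" "generate G {a, b} = carrier G"
      "\<not> solvable_pair G a b"
    and transitive: "\<lbrakk>x \<in> carrier G - Sol G; y \<in> carrier G - Sol G; z \<in> carrier G - Sol G;
      solvable_pair G x y; solvable_pair G y z\<rbrakk> \<Longrightarrow> solvable_pair G x z"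
begin

abbreviation S where "S \<equiv> Sol G"
abbreviation N where "N \<equiv> carrier G - Sol G"

lemma S_carrier: "s \<in> S \<Longrightarrow> s \<in> carrier G"
  by (simp add: Sol_iff)

lemma S_pair:
  assumes "s \<in> S" "y \<in> carrier G"
  shows "solvable_pair G s y" "solvable_pair G y s"
  using assms by (auto simp: Sol_iff solvable_pair_commute[of G y s])

lemma generators_mem_N: "a \<in> N" "b \<in> N"
  using ab S_pair by blast+

lemma ex_nonsolvable_pair:
  assumes "u \<in> N"
  shows "\<exists>v \<in> N. \<not> solvable_pair G u v"
  using transitive[of a u b] generators_mem_N assms ab(4) solvable_pair_commute by metis

text \<open>Suppose that \<open>t \<otimes> z\<close> were not in \<open>S\<close>. Write \<open>x ~ y\<close> for a pair that generates a
  solvable subgroup. Then \<open>t \<otimes> z ~ z\<close> because \<open>t \<in> S\<close>, and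
  \<open>s \<otimes> t \<otimes> z ~ t \<otimes> z\<close> because \<open>s \<in> S\<close>. Hence
  \<open>s \<otimes> t \<otimes> z ~ z\<close>, by transitivity or because \<open>s \<otimes> t \<otimes> z\<close> lies in \<open>S\<close>, and
  therefore \<open>s \<otimes> t ~ z\<close>, contrary to assumption.\<close>
lemma Sol_mult_step:
  assumes s: "s \<in> S" and t: "t \<in> S" and st: "s \<otimes> t \<notin> S" and z: "z \<in> N"
    and nonsolv: "\<not> solvable_pair G (s \<otimes> t) z"
  shows "t \<otimes> z \<in> S"
proof (rule ccontr)
  assume tz: "t \<otimes> z \<notin> S"
  have carr: "s \<in> carrier G" "t \<in> carrier G" "z \<in> carrier G"
    using assms S_carrier by auto
  have tz_z: "solvable_pair G (t \<otimes> z) z"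
    using S_pair(1)[OF t, of z] carr by (simp add: solvable_pair_mult)
  have "solvable_pair G (s \<otimes> (t \<otimes> z)) (t \<otimes> z)"
    using S_pair(1)[OF s, of "t \<otimes> z"] carr by (simp add: solvable_pair_mult)
  then have stz: "solvable_pair G (s \<otimes> t \<otimes> z) (t \<otimes> z)"
    using carr by (simp add: m_assoc)
  have "solvable_pair G (s \<otimes> t \<otimes> z) z"
  proof (cases "s \<otimes> t \<otimes> z \<in> S")
    case True
    then show ?thesis using S_pair carr by blast
  next
    case False
    then show ?thesis
      using transitive[of "s \<otimes> t \<otimes> z" "t \<otimes> z" z] stz tz_z tz z carr by auto
  qed
  then show False
    using nonsolv carr by (simp add: solvable_pair_mult)
qed

text \<open>The remaining case is that \<open>s \<otimes> t\<close> and \<open>z\<close> are equivalent. Choose \<open>v\<close> in another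
  class. Then \<open>t \<otimes> v\<close> lies in \<open>S\<close>, and the inverse of \<open>v\<close> is again a product of two
  elements of \<open>S\<close> whose second factor is \<open>t\<close>, namely of the inverse of \<open>t \<otimes> v\<close> and
  \<open>t\<close>. Since \<open>z\<close> is not equivalent to \<open>v\<close>, the preceding lemma applies to this
  product.\<close>
lemma Sol_mult_N:
  assumes s: "s \<in> S" and t: "t \<in> S" and st: "s \<otimes> t \<notin> S" and z: "z \<in> N"
  shows "t \<otimes> z \<in> S"
proof (cases "solvable_pair G (s \<otimes> t) z")
  case True
  have carr: "s \<in> carrier G" "t \<in> carrier G" "z \<in> carrier G"
    using assms S_carrier by auto
  obtain v where v: "v \<in> N" "\<not> solvable_pair G (s \<otimes> t) v"
    using ex_nonsolvable_pair[of "s \<otimes> t"] st carr by auto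
  have tv: "t \<otimes> v \<in> S"
    using Sol_mult_step[OF s t st v] .
  have inv_v: "inv (t \<otimes> v) \<otimes> t = inv v"
    using carr v by (simp add: inv_mult_group m_assoc)
  have "inv v \<notin> S"
    using v Sol_inv[of "inv v"] by auto
  moreover have "\<not> solvable_pair G v z"
    using transitive[of "s \<otimes> t" z v] True v z st carr solvable_pair_commute[of G v z] by auto
  ultimately show ?thesis
    using Sol_mult_step[OF Sol_inv[OF tv] t _ z] v carr unfolding inv_v
    by (simp add: solvable_pair_inv)
qed (use Sol_mult_step assms in blast)

text \<open>If \<open>s \<otimes> t\<close> were outside \<open>S\<close>, then \<open>t\<close> would belong to the set \<open>M\<close> of
  elements of \<open>S\<close> whose right multiples by elements of \<open>N\<close> all stay in \<open>S\<close>. By the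
  preceding lemma, \<open>M\<close> is closed under right multiplication by \<open>N\<close>. As \<open>N\<close> generates the
  group, \<open>M\<close> and with it \<open>S\<close> would be the whole group.\<close>
lemma Sol_mult:
  assumes s: "s \<in> S" and t: "t \<in> S"
  shows "s \<otimes> t \<in> S"
proof (rule ccontr)
  assume st: "s \<otimes> t \<notin> S"
  define M where "M = {m \<in> S. \<forall>z \<in> N. m \<otimes> z \<in> S}"
  have t: "t \<in> M"
    using Sol_mult_N[OF s t st] t by (auto simp: M_def)
  have step: "m \<otimes> v \<in> M" if "m \<in> M" "v \<in> N" for m v
  proof -
    have m: "m \<in> S" "m \<otimes> v \<in> S" "m \<in> carrier G" "v \<in> carrier G"
      using that S_carrier by (auto simp: M_def)
    \<comment> \<open>So \<open>m \<otimes> v\<close> is the second factor of a product of elements of \<open>S\<close> that is not in \<open>S\<close>.\<close>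
    have "inv m \<otimes> (m \<otimes> v) \<notin> S"
      using that m by (simp add: inv_mult_cancel_left)
    then show ?thesis
      using Sol_mult_N[OF Sol_inv[OF m(1)] m(2)] m(2) by (auto simp: M_def)
  qed
  have "\<forall>m \<in> M. m \<otimes> g \<in> M" if "g \<in> generate G {a, b}" for g
    using that
  proof induction
    case one
    then show ?case by (simp add: M_def S_carrier)
  next
    case (incl h)
    then show ?case using step generators_mem_N by blast
  next
    case (inv h)
    then have "h \<in> N" using generators_mem_N by blast
    then have "inv h \<in> N" using Sol_inv[of "inv h"] by auto
    then show ?case using step by blast
  next
    case (eng h1 h2)
    have "h1 \<in> carrier G" "h2 \<in> carrier G"
      using eng.hyps ab by simp_all
    then have "m \<otimes> (h1 \<otimes> h2) = (m \<otimes> h1) \<otimes> h2" if "m \<in> M" for m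
      using that by (simp add: m_assoc M_def S_carrier)
    then show ?case using eng.IH by simp
  qed
  \<comment> \<open>Closure under right multiplication by the whole group moves \<open>t\<close> to \<open>a\<close>.\<close>
  then have "t \<otimes> (inv t \<otimes> a) \<in> M"
    using t ab S_carrier by (auto simp: M_def)
  then have "a \<in> S"
    using t ab S_carrier by (auto simp: M_def inv_mult_cancel_left)
  then show False using generators_mem_N by blast
qed

lemma subgroup_Sol: "subgroup S G"
  using one_mem_Sol[OF fin] Sol_mult Sol_inv S_carrier
  by (intro subgroup.intro) auto

definition solvabilizer where "solvabilizer x = {y \<in> carrier G. solvable_pair G x y}"

lemma Sol_subset_solvabilizer: "x \<in> carrier G \<Longrightarrow> S \<subseteq> solvabilizer x"
  using S_pair S_carrier by (auto simp: solvabilizer_def)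

text \<open>The solvabilizer of \<open>x \<in> N\<close> is the class of \<open>x\<close> together with \<open>S\<close>. If a product
  \<open>y \<otimes> z\<close> of two of its elements is not in \<open>S\<close>, one of the factors, being outside \<open>S\<close>,
  is equivalent both to \<open>x\<close> and to the product.\<close>
lemma subgroup_solvabilizer:
  assumes x: "x \<in> N"
  shows "subgroup (solvabilizer x) G"
proof (rule finite_submonoid_is_subgroup[OF fin])
  show "\<one> \<in> solvabilizer x"
    using Sol_subset_solvabilizer one_mem_Sol[OF fin] x by blast
next
  fix y z assume yz: "y \<in> solvabilizer x" "z \<in> solvabilizer x"
  then have carr: "y \<in> carrier G" "z \<in> carrier G"
    by (auto simp: solvabilizer_def)
  have xy: "solvable_pair G x y" "solvable_pair G x z"
    using yz by (auto simp: solvabilizer_def)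
  show "y \<otimes> z \<in> solvabilizer x"
  proof (cases "y \<otimes> z \<in> S")
    case True
    then show ?thesis using Sol_subset_solvabilizer x by blast
  next
    case False
    have y_z: "solvable_pair G y z"
      using transitive[of y x z] xy x carr S_pair solvable_pair_commute by (metis DiffI)
    then have prod: "solvable_pair G y (y \<otimes> z)" "solvable_pair G z (y \<otimes> z)"
      using carr solvable_pair_mult[of y z] solvable_pair_commute by metis+
    have "y \<in> N \<or> z \<in> N"
      using False Sol_mult carr by blast
    then have "solvable_pair G x (y \<otimes> z)"
      using transitive[of x _ "y \<otimes> z"] prod xy x False carr by blast
    then show ?thesis using carr by (simp add: solvabilizer_def)
  qed
qed (auto simp: solvabilizer_def)

lemma solvabilizer_memI:
  assumes "x \<in> N" "u \<in> solvabilizer x - S" "v \<in> carrier G" "solvable_pair G u v"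
  shows "v \<in> solvabilizer x"
  using assms transitive[of x u v] S_pair(2)[of v x] by (auto simp: solvabilizer_def)

lemma solvabilizer_pair:
  assumes "x \<in> N" "u \<in> solvabilizer x" "v \<in> solvabilizer x"
  shows "solvable_pair G u v"
  using assms transitive[of u x v] S_pair[of u v] S_pair[of v u] solvable_pair_commute[of G x u]
  by (auto simp: solvabilizer_def)

lemma conj_solvabilizer:
  assumes x: "x \<in> N" and u: "u \<in> solvabilizer x - S" and k: "k \<in> carrier G"
    and ku: "k \<otimes> u \<otimes> inv k \<in> solvabilizer x" and w: "w \<in> solvabilizer x"
  shows "k \<otimes> w \<otimes> inv k \<in> solvabilizer x"
proof -
  have carr: "u \<in> carrier G" "w \<in> carrier G"
    using u w by (auto simp: solvabilizer_def)
  have "solvable_pair G (k \<otimes> u \<otimes> inv k) (k \<otimes> w \<otimes> inv k)"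
    using u w x by (intro solvable_pair_conj solvabilizer_pair[of x] k carr) auto
  then show ?thesis
    using solvabilizer_memI[OF x, of "k \<otimes> u \<otimes> inv k"] u ku k carr by (simp add: Sol_conj_iff)
qed

section \<open>Conjugates of a solvabilizer\<close>

text \<open>Conjugation permutes the classes, so \<open>k\<close> normalises the solvabilizer \<open>A\<close> of \<open>x\<close>.
  A Frattini argument then puts \<open>k\<close> into \<open>A\<close>. Take a Sylow subgroup \<open>P\<close> of \<open>A\<close> that is
  not contained in \<open>S\<close>. For some \<open>g \<in> A\<close> the product \<open>g \<otimes> k\<close> normalises \<open>P\<close>, so that
  it generates a solvable group with \<open>P\<close>. Thus \<open>g \<otimes> k\<close> is equivalent to an element of
  \<open>P\<close> outside \<open>S\<close> and belongs to \<open>A\<close>.\<close>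
lemma solvabilizer_malnormal:
  assumes x: "x \<in> N" and u: "u \<in> solvabilizer x - S" and k: "k \<in> carrier G"
    and ku: "k \<otimes> u \<otimes> inv k \<in> solvabilizer x"
  shows "k \<in> solvabilizer x"
proof -
  define A where "A = solvabilizer x"
  have A: "subgroup A G" unfolding A_def by (rule subgroup_solvabilizer[OF x])
  have SA: "S \<subset> A"
    using Sol_subset_solvabilizer[of x] x u unfolding A_def by blast
  obtain m where m: "card A = m * card S" "m \<ge> 2"
    using card_subgroup_double[OF fin A subgroup_Sol SA] .
  have "card S > 0"
    using subgroup.finite_imp_card_positive[OF subgroup_Sol fin] .
  \<comment> \<open>A prime dividing the index of \<open>S\<close>: its Sylow subgroups of \<open>A\<close> are not in \<open>S\<close>.\<close>
  obtain p where p: "prime p" "p dvd m"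
    using prime_factor_nat[of m] m(2) by auto
  obtain P j where P: "subgroup P G" "P \<subseteq> A" "card P = p ^ j"
    and conj: "\<And>Q. subgroup Q G \<Longrightarrow> Q \<subseteq> A \<Longrightarrow> card Q = p ^ j \<Longrightarrow> \<exists>g\<in>A. \<forall>h\<in>Q. g \<otimes> h \<otimes> inv g \<in> P"
    and max: "\<And>B. subgroup B G \<Longrightarrow> P \<subseteq> B \<Longrightarrow> B \<subseteq> A \<Longrightarrow> \<not> p dvd (card A div card B)"
    using ex_sylow_subgroup[OF fin A p(1)] by metis
  have "\<not> P \<subseteq> S"
    using max[OF subgroup_Sol] SA p(2) m(1) \<open>card S > 0\<close> by auto
  then obtain v where v: "v \<in> P" "v \<notin> S" by blast
  have P_carr: "h \<in> carrier G" if "h \<in> P" for h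
    using subgroup.mem_carrier[OF P(1) that] .
  interpret c: group_hom G G "\<lambda>x. k \<otimes> x \<otimes> inv k"
    by (rule group_hom_conj[OF k])
  let ?Q = "(\<lambda>x. k \<otimes> x \<otimes> inv k) ` P"
  have "inj_on (\<lambda>x. k \<otimes> x \<otimes> inv k) P"
    using P_carr k by (intro inj_onI) simp
  then have "card ?Q = p ^ j"
    using P(3) by (simp add: card_image)
  moreover have "?Q \<subseteq> A"
    using conj_solvabilizer[OF x u k ku] P(2) unfolding A_def by auto
  ultimately obtain g where g: "g \<in> A" "\<And>h. h \<in> P \<Longrightarrow> g \<otimes> (k \<otimes> h \<otimes> inv k) \<otimes> inv g \<in> P"
    using conj[OF c.subgroup_img_is_subgroup[OF P(1)]] by auto
  have g_carr: "g \<in> carrier G" using g(1) subgroup.mem_carrier[OF A] by blast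
  have norm: "(g \<otimes> k) \<otimes> h \<otimes> inv (g \<otimes> k) \<in> P" if "h \<in> P" for h
    using g(2)[OF that] g_carr k P_carr[OF that] by (simp add: inv_mult_group m_assoc)
  have "solvable (G\<lparr>carrier := P\<rparr>)"
    using group.p_group_solvable[OF subgroup_imp_group[OF P(1)] p(1)] P(3) by (simp add: order_def)
  then have "solvable_seq G P"
    using solvable_carrier_iff_solvable_seq[OF P(1)] by simp
  then have "solvable_seq G (generate G (insert (g \<otimes> k) P))"
    using solvable_seq_generate_insert[OF fin] norm g_carr k by blast
  then have "solvable_pair G v (g \<otimes> k)"
    by (rule solvable_pair_in_solvable_seq) (auto intro: generate.incl v(1))
  then have "g \<otimes> k \<in> A"
    using solvabilizer_memI[OF x, of v "g \<otimes> k"] v P(2) g_carr k unfolding A_def by auto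
  then have "inv g \<otimes> (g \<otimes> k) \<in> A"
    using g(1) A by (simp add: subgroup.m_closed subgroup.m_inv_closed)
  then show ?thesis
    using g_carr k by (simp add: inv_mult_cancel_left A_def)
qed

definition conjugates where
  "conjugates x = (\<lambda>(g, u). g \<otimes> u \<otimes> inv g) ` (carrier G \<times> (solvabilizer x - S))"

text \<open>Consider the conjugation map from pairs \<open>(g, u)\<close> to the elements they produce. By
  malnormality two pairs in the same fibre have first components in the same left coset of the
  solvabilizer, and every element of that coset occurs. So all fibres have the size of the
  solvabilizer.\<close>
lemma card_conjugates:
  assumes x: "x \<in> N"
  shows "card (conjugates x) * card (solvabilizer x) = order G * card (solvabilizer x - S)"
proof -
  define A where "A = solvabilizer x"
  define f where "f = (\<lambda>(g, u). g \<otimes> u \<otimes> inv g)"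
  define D where "D = carrier G \<times> (A - S)"
  have A: "subgroup A G" unfolding A_def by (rule subgroup_solvabilizer[OF x])
  interpret A: subgroup A G by (rule A)
  have finA: "finite A" using fin A.subset finite_subset by blast
  have D: "finite D" using fin finA by (simp add: D_def)
  have fibre: "card {d \<in> D. f d = z} = card A" if z: "z \<in> f ` D" for z
  proof -
    obtain h b where hb: "h \<in> carrier G" "b \<in> A - S" "z = h \<otimes> b \<otimes> inv h"
      using z by (auto simp: D_def f_def)
    have b: "b \<in> carrier G" using hb(2) A.mem_carrier by blast
    \<comment> \<open>The pairs over \<open>z\<close> are the translates of one of them, \<open>(h, b)\<close>, by elements of \<open>A\<close>.\<close>
    have "bij_betw (\<lambda>a. (h \<otimes> a, inv a \<otimes> b \<otimes> a)) A {d \<in> D. f d = z}"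
      unfolding bij_betw_def
    proof (intro conjI equalityI subsetI)
      show "inj_on (\<lambda>a. (h \<otimes> a, inv a \<otimes> b \<otimes> a)) A"
        using hb(1) by (intro inj_onI) simp
    next
      fix d assume "d \<in> (\<lambda>a. (h \<otimes> a, inv a \<otimes> b \<otimes> a)) ` A"
      then obtain a where a: "a \<in> A" "d = (h \<otimes> a, inv a \<otimes> b \<otimes> a)" by blast
      then have ac: "a \<in> carrier G" by simp
      have "inv a \<otimes> b \<otimes> a \<notin> S"
        using Sol_conj_iff[of b "inv a"] hb(2) b ac by simp
      then show "d \<in> {d \<in> D. f d = z}"
        using a(1) hb b ac unfolding a(2) f_def D_def
        by (simp add: inv_mult_group m_assoc inv_mult_cancel_left)
    next
      fix d assume d: "d \<in> {d \<in> D. f d = z}"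
      then obtain g u where gu: "d = (g, u)" "g \<in> carrier G" "u \<in> A - S" "g \<otimes> u \<otimes> inv g = h \<otimes> b \<otimes> inv h"
        by (auto simp: D_def f_def hb(3))
      have u: "u \<in> carrier G" using gu(3) A.mem_carrier by blast
      define a where "a = inv h \<otimes> g"
      have ac: "a \<in> carrier G" using hb gu by (simp add: a_def)
      have "a \<otimes> u \<otimes> inv a = inv h \<otimes> (g \<otimes> u \<otimes> inv g) \<otimes> h"
        using hb(1) gu(2) u by (simp add: a_def inv_mult_group m_assoc)
      then have au: "a \<otimes> u \<otimes> inv a = b"
        unfolding gu(4) using conj_inv_conj hb(1) b by simp
      then have "a \<in> A"
        using solvabilizer_malnormal[OF x _ ac, of u] gu(3) hb(2) unfolding A_def by blast
      moreover have "h \<otimes> a = g"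
        using hb gu by (simp add: a_def inv_mult_cancel_left)
      moreover have "inv a \<otimes> b \<otimes> a = u"
        unfolding au[symmetric] using conj_inv_conj ac u by simp
      ultimately show "d \<in> (\<lambda>a. (h \<otimes> a, inv a \<otimes> b \<otimes> a)) ` A"
        using gu(1) by blast
    qed
    then show ?thesis
      by (simp add: bij_betw_same_card)
  qed
  have "card D = (\<Sum>z\<in>f ` D. card {d \<in> D. f d = z})"
    using sum.group[OF D finite_imageI[OF D] subset_refl[of "f ` D"], where h = "\<lambda>_. 1::nat"] by simp
  also have "\<dots> = card (f ` D) * card A"
    using fibre by simp
  finally show ?thesis
    by (simp add: D_def f_def A_def conjugates_def card_cartesian_product order_def)
qed

lemma conjugates_subset_N: "conjugates x \<subseteq> N"
  by (auto simp: conjugates_def solvabilizer_def Sol_conj_iff)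

lemma finite_N: "finite N"
  using fin by simp

text \<open>As a proper subgroup, \<open>S\<close> is at most half of the solvabilizer.\<close>
lemma card_conjugates_ge_half:
  assumes x: "x \<in> N"
  shows "order G \<le> 2 * card (conjugates x)"
proof -
  let ?A = "solvabilizer x"
  have A: "subgroup ?A G" by (rule subgroup_solvabilizer[OF x])
  have finA: "finite ?A" using fin subgroup.subset[OF A] finite_subset by blast
  have SA: "S \<subset> ?A"
    using Sol_subset_solvabilizer[of x] x solvable_pair_self[OF fin] by (auto simp: solvabilizer_def)
  obtain m where m: "card ?A = m * card S" "m \<ge> 2"
    using card_subgroup_double[OF fin A subgroup_Sol SA] .
  have pos: "card ?A > 0"
    using subgroup.finite_imp_card_positive[OF A fin] .
  have "2 * card S \<le> card ?A"
    using m by simp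
  moreover have "card (?A - S) = card ?A - card S"
    using SA finA finite_subset by (intro card_Diff_subset) auto
  ultimately have "card ?A \<le> 2 * card (?A - S)" by simp
  then have "order G * card ?A \<le> 2 * (order G * card (?A - S))"
    by (metis mult.left_commute mult_le_mono2)
  then have "order G * card ?A \<le> (2 * card (conjugates x)) * card ?A"
    by (simp only: card_conjugates[OF x] mult.assoc)
  then show ?thesis using pos by (simp only: mult_le_cancel2 simp_thms)
qed

text \<open>As there are at least two classes, the solvabilizer of \<open>x\<close> is a proper subgroup. The
  exact count excludes equality, just as it shows that a finite group is not the union of the
  conjugates of a proper subgroup.\<close>
lemma conjugates_ne_N:
  assumes x: "x \<in> N"
  shows "conjugates x \<noteq> N"
proof
  assume eq: "conjugates x = N"
  let ?A = "solvabilizer x"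
  have A: "subgroup ?A G" by (rule subgroup_solvabilizer[OF x])
  have A_sub: "?A \<subseteq> carrier G" by (rule subgroup.subset[OF A])
  have finA: "finite ?A" using fin A_sub finite_subset by blast
  have SA: "S \<subseteq> ?A"
    using Sol_subset_solvabilizer x by blast
  have finS: "finite S" using SA finA finite_subset by blast
  obtain v where v: "v \<in> N" "\<not> solvable_pair G x v"
    using ex_nonsolvable_pair[OF x] by blast
  then have "?A \<subset> carrier G"
    using A_sub by (auto simp: solvabilizer_def)
  then have less: "card ?A < order G"
    unfolding order_def by (rule psubset_card_mono[OF fin])
  have "card N = order G - card S" "card (?A - S) = card ?A - card S"
    using card_Diff_subset[OF finS] SA A_sub by (auto simp: order_def)
  then have "(order G - card S) * card ?A = order G * (card ?A - card S)"
    using card_conjugates[OF x] eq by simp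
  then have "order G * card ?A - card S * card ?A = order G * card ?A - order G * card S"
    by (simp only: diff_mult_distrib diff_mult_distrib2)
  moreover have "card S * card ?A \<le> order G * card ?A" "order G * card S \<le> order G * card ?A"
    using card_mono[OF finA SA] less by simp_all
  ultimately have "card S * card ?A = order G * card S"
    by linarith
  moreover have "card S > 0"
    using subgroup.finite_imp_card_positive[OF subgroup_Sol fin] .
  ultimately show False using less by (simp add: mult.commute[of "card S"])
qed

text \<open>An element \<open>z \<in> N\<close> that is not conjugate into the solvabilizer of \<open>x\<close> has a class
  none of whose elements is. The conjugates for \<open>x\<close> and for \<open>z\<close> are then two disjoint
  subsets of \<open>N\<close>, each at least half as large as the group, although \<open>N\<close> misses the
  identity.\<close>
lemma impossible: False
proof -
  obtain x where x: "x \<in> N" using generators_mem_N by blast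
  obtain z where z: "z \<in> N" "z \<notin> conjugates x"
    using conjugates_ne_N[OF x] conjugates_subset_N[of x] by blast
  have "conjugates x \<inter> conjugates z = {}"
  proof (rule ccontr)
    assume "\<not> ?thesis"
    then obtain g u h v where gu: "g \<in> carrier G" "u \<in> solvabilizer x - S"
      and hv: "h \<in> carrier G" "v \<in> solvabilizer z - S"
      and eq: "g \<otimes> u \<otimes> inv g = h \<otimes> v \<otimes> inv h"
      by (fastforce simp: conjugates_def)
    have carr: "u \<in> carrier G" "v \<in> carrier G" "z \<in> carrier G"
      using gu hv z by (auto simp: solvabilizer_def)
    \<comment> \<open>Conjugation by \<open>k\<close> takes \<open>v\<close> to \<open>u\<close>, hence the class of \<open>z\<close> to the class of \<open>x\<close>.\<close>
    define k where "k = inv g \<otimes> h"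
    have k: "k \<in> carrier G" using gu hv by (simp add: k_def)
    have "k \<otimes> v \<otimes> inv k = inv g \<otimes> (h \<otimes> v \<otimes> inv h) \<otimes> g"
      using gu hv carr by (simp add: k_def inv_mult_group m_assoc)
    then have kv: "k \<otimes> v \<otimes> inv k = u"
      unfolding eq[symmetric] using conj_inv_conj gu(1) carr by simp
    have "solvable_pair G v z"
      using hv(2) solvable_pair_commute[of G v z] by (simp add: solvabilizer_def)
    then have "solvable_pair G u (k \<otimes> z \<otimes> inv k)"
      using solvable_pair_conj[of v z k] k carr by (simp add: kv)
    then have "k \<otimes> z \<otimes> inv k \<in> solvabilizer x - S"
      using solvabilizer_memI[OF x gu(2)] z k carr by (simp add: Sol_conj_iff)
    moreover have "z = inv k \<otimes> (k \<otimes> z \<otimes> inv k) \<otimes> inv (inv k)"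
      using k carr conj_inv_conj(1)[of k z] by simp
    ultimately have "z \<in> conjugates x"
      unfolding conjugates_def using k by (intro image_eqI[of _ _ "(inv k, k \<otimes> z \<otimes> inv k)"]) auto
    then show False using z by simp
  qed
  then have "card (conjugates x) + card (conjugates z) = card (conjugates x \<union> conjugates z)"
    using finite_subset[OF conjugates_subset_N finite_N] by (simp add: card_Un_disjoint)
  also have "\<dots> \<le> card N"
    using conjugates_subset_N finite_N by (intro card_mono) auto
  also have "\<dots> < order G"
    unfolding order_def using one_mem_Sol[OF fin] one_closed
    by (intro psubset_card_mono[OF fin]) blast
  finally show False
    using card_conjugates_ge_half[OF x] card_conjugates_ge_half[OF z(1)] by linarith
qed

end

section \<open>The non-solvable graph\<close>

text \<open>Elements of a subgroup \<open>H\<close> that are outside \<open>Sol H\<close> are outside \<open>Sol G\<close>, and the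
  subgroup generated by a pair in \<open>H\<close> does not depend on the ambient group. This is why
  transitivity passes to the subgroup generated by an adjacent pair.\<close>
theorem nonsolvable_graph_not_multipartite:
  assumes "group G" and fin: "finite (carrier G)"
  shows "\<not> complete_multipartite_digraph (with_proj (nonsolvable_graph G))"
proof
  interpret group G by fact
  let ?N = "carrier G - Sol G"
  assume "complete_multipartite_digraph (with_proj (nonsolvable_graph G))"
  then obtain P where part: "partition_on ?N P" and two: "card P \<ge> 2" and
    arcs: "parcs (nonsolvable_graph G) = {(u, v). \<exists>A\<in>P. \<exists>B\<in>P. A \<noteq> B \<and> u \<in> A \<and> v \<in> B}"
    by (auto simp: complete_multipartite_digraph_def complete_partite_digraph_def
        arcs_ends_def arc_to_ends_def nonsolvable_graph_def)
  have cover: "\<exists>A\<in>P. x \<in> A" if "x \<in> ?N" for x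
    using partition_onD1[OF part] that by blast
  have mem_N: "x \<in> ?N" if "A \<in> P" "x \<in> A" for A x
    using partition_onD1[OF part] that by blast
  have unique: "A = B" if "A \<in> P" "B \<in> P" "x \<in> A" "x \<in> B" for x A B
    using disjointD[OF partition_onD2[OF part] that(1,2)] that(3,4) by blast
  have adj: "\<not> solvable_pair G x y" if "A \<in> P" "B \<in> P" "A \<noteq> B" "x \<in> A" "y \<in> B" for x y A B
  proof -
    have "(x, y) \<in> parcs (nonsolvable_graph G)"
      unfolding arcs using that by blast
    then show ?thesis
      by (simp add: nonsolvable_graph_def solvable_pair_def)
  qed
  have nonadj: "solvable_pair G x y" if "A \<in> P" "x \<in> A" "y \<in> A" for x y A
  proof (cases "x = y")
    case True
    then show ?thesis using solvable_pair_self[OF fin] mem_N that by blast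
  next
    case False
    have "(x, y) \<notin> parcs (nonsolvable_graph G)"
      unfolding arcs using that unique by blast
    then show ?thesis
      using False mem_N that by (auto simp: nonsolvable_graph_def solvable_pair_def)
  qed
  have trans: "solvable_pair G x z"
    if "x \<in> ?N" "y \<in> ?N" "z \<in> ?N" "solvable_pair G x y" "solvable_pair G y z" for x y z
    using cover adj nonadj that by metis
  obtain A B where AB: "A \<in> P" "B \<in> P" "A \<noteq> B"
    using two by (metis One_nat_def Suc_1 card_le_Suc0_iff_eq card.infinite not_less_eq_eq zero_le)
  obtain a b where ab: "a \<in> A" "b \<in> B"
    using partition_onD3[OF part] AB by (metis all_not_in_conv)
  have ab_carr: "a \<in> carrier G" "b \<in> carrier G"
    using mem_N AB ab by blast+
  define H where "H = generate G {a, b}"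
  have H: "subgroup H G"
    unfolding H_def using ab_carr by (intro generate_is_subgroup) auto
  have H_sub: "H \<subseteq> carrier G" by (rule subgroup.subset[OF H])
  interpret H: group "G\<lparr>carrier := H\<rparr>" by (rule subgroup_imp_group[OF H])
  have gen: "generate (G\<lparr>carrier := H\<rparr>) {x, y} = generate G {x, y}" if "x \<in> H" "y \<in> H" for x y
    using that by (intro generate_consistent H) auto
  have pair: "solvable_pair (G\<lparr>carrier := H\<rparr>) x y \<longleftrightarrow> solvable_pair G x y" if "x \<in> H" "y \<in> H" for x y
    using gen[OF that] by (simp add: solvable_pair_def)
  have Sol: "x \<notin> Sol G" if "x \<in> H" "x \<notin> Sol (G\<lparr>carrier := H\<rparr>)" for x
    using that pair[OF that(1)] H_sub by (auto simp: Sol_iff)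
  have ab_H: "a \<in> H" "b \<in> H"
    by (auto simp: H_def intro: generate.incl)
  interpret transitive_solvability "G\<lparr>carrier := H\<rparr>" a b
  proof
    show "finite (carrier (G\<lparr>carrier := H\<rparr>))"
      using fin H_sub finite_subset by auto
    show "generate (G\<lparr>carrier := H\<rparr>) {a, b} = carrier (G\<lparr>carrier := H\<rparr>)"
      using gen[OF ab_H] by (simp add: H_def)
    show "\<not> solvable_pair (G\<lparr>carrier := H\<rparr>) a b"
      using pair[OF ab_H] adj AB ab by blast
    fix x y z
    assume xyz: "x \<in> carrier (G\<lparr>carrier := H\<rparr>) - Sol (G\<lparr>carrier := H\<rparr>)"
      "y \<in> carrier (G\<lparr>carrier := H\<rparr>) - Sol (G\<lparr>carrier := H\<rparr>)"
      "z \<in> carrier (G\<lparr>carrier := H\<rparr>) - Sol (G\<lparr>carrier := H\<rparr>)"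
      and "solvable_pair (G\<lparr>carrier := H\<rparr>) x y" "solvable_pair (G\<lparr>carrier := H\<rparr>) y z"
    then have "solvable_pair G x y" "solvable_pair G y z"
      using pair by simp_all
    then have "solvable_pair G x z"
      using trans[of x y z] xyz Sol H_sub by auto
    then show "solvable_pair (G\<lparr>carrier := H\<rparr>) x z"
      using pair xyz by simp
  qed (use ab_H in auto)
  show False by (rule impossible)
qed

theorem theorem3p3:
  fixes G :: "('a, 'b) monoid_scheme"
  assumes "group G" and "finite (carrier G)" and "\<not> solvable G"
  shows "\<not> complete_multipartite_digraph (with_proj (nonsolvable_graph G)) \<and>
    \<not> (\<exists>m\<ge>1. \<exists>n\<ge>1. complete_bipartite_digraph m n (with_proj (nonsolvable_graph G)))"
proof
  show *: "\<not> complete_multipartite_digraph (with_proj (nonsolvable_graph G))"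
    by (rule nonsolvable_graph_not_multipartite[OF assms(1,2)])
  show "\<not> (\<exists>m\<ge>1. \<exists>n\<ge>1. complete_bipartite_digraph m n (with_proj (nonsolvable_graph G)))"
    using * unfolding complete_multipartite_digraph_def complete_partite_2_iff[symmetric] by blast
qed

end
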